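(* Let $\beta$ be a complex number and let $n\ge 1$ be an integer. For integers $m\ge 0$ put $c_{n,m}=[x^n]\,{}_{(\beta)}a^{m}(x)$, where ${}_{(\beta)}a^{m}(x)$ is the $m$-th power of the generalized binomial series ${}_{(\beta)}a(x)$. Define the formal power series ${}_{(\beta)}\alpha_n(x)=(1-x)^{n+1}\sum_{m\ge 0}c_{n,m}x^m$. Then $${}_{(\beta)}\alpha_n(x)=\frac{1}{n}\sum_{m=0}^{n}\binom{n(1-\beta)}{m-1}\binom{n\beta}{n-m}x^m .$$
   Context: For complex $y$ and integer $k$, $\binom{y}{k}=y(y-1)\cdots(y-k+1)/k!$ if $k\ge 0$ and $\binom{y}{k}=0$ if $k<0$. The generalized binomial series ${}_{(\beta)}a(x)$ is the formal power series whose powers are ${}_{(\beta)}a^{\varphi}(x)=\sum_{k\ge0}\frac{\varphi}{\varphi+k\beta}\binom{\varphi+k\beta}{k}x^k$ for every $\varphi$; here the coefficient of $x^k$ for $k\ge1$ is to be read as the polynomial $\frac{\varphi}{k}\binom{\varphi+k\beta-1}{k-1}$ in $\varphi,\beta$ (so the coefficient of $x^k$, $k\ge 1$, vanishes for $\varphi=0$), and the coefficient of $x^0$ is $1$. (E.g. ${}_{(0)}a(x)=1+x$, ${}_{(1)}a(x)=1/(1-x)$.) Equivalently, $\sum_{m\ge0}c_{n,m}x^m$ is the generating function of the $n$-th descending diagonal of the Riordan matrix whose $m$-th column has generating function $(x\,{}_{(\beta)}a(x))^m$. *)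

theory Defs
  imports Complex_Main "HOL-Computational_Algebra.Formal_Power_Series"
begin

definition cbinom :: "complex \<Rightarrow> int \<Rightarrow> complex" where
  "cbinom y k = (if k < 0 then 0 else y gchoose (nat k))"

lemma cbinom_nonneg: "k \<ge> 0 \<Longrightarrow> cbinom y k = (\<Prod>i<nat k. y - of_nat i) / fact (nat k)"
  by (simp add: cbinom_def gbinomial_prod_rev atLeast0LessThan)

(* The coefficient of x^k in the phi-th power of the generalized binomial series.  For k > 0 it is
   the polynomial form of phi / (phi + k beta) * binom (phi + k beta) k, which also makes sense
   when phi + k beta = 0; see gen_binom_coeff_quotient. *)
definition gen_binom_coeff :: "complex \<Rightarrow> complex \<Rightarrow> nat \<Rightarrow> complex" where
  "gen_binom_coeff \<beta> \<phi> k =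
     (if k = 0 then 1
      else \<phi> / of_nat k * cbinom (\<phi> + of_nat k * \<beta> - 1) (int k - 1))"

lemma gen_binom_coeff_quotient:
  assumes "\<phi> + of_nat k * \<beta> \<noteq> 0"
  shows "gen_binom_coeff \<beta> \<phi> k =
           \<phi> / (\<phi> + of_nat k * \<beta>) * cbinom (\<phi> + of_nat k * \<beta>) (int k)"
proof (cases k)
  case 0
  then show ?thesis using assms by (simp add: gen_binom_coeff_def cbinom_def)
next
  case (Suc j)
  have "(\<phi> + of_nat k * \<beta>) gchoose k =
      (\<phi> + of_nat k * \<beta>) / of_nat k * ((\<phi> + of_nat k * \<beta> - 1) gchoose (k - 1))"
    using Suc by (intro gbinomial_absorption') simp
  moreover have "nat (int k - 1) = k - 1" using Suc by simp
  ultimately show ?thesis using assms Suc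
    by (simp add: gen_binom_coeff_def cbinom_def del: of_nat_Suc)
qed

(* The series itself is the case phi = 1; its m-th power is the ordinary power of formal
   power series. *)
definition gen_binom_series :: "complex \<Rightarrow> complex fps" where
  "gen_binom_series \<beta> = Abs_fps (gen_binom_coeff \<beta> 1)"

lemma gen_binom_series_0: "gen_binom_series 0 = 1 + fps_X"
proof (rule fps_ext)
  fix k :: nat
  have "cbinom 0 (int k - 1) = 0" if "k > 1"
    using that by (cases "nat (int k - 1)") (auto simp: cbinom_def)
  then show "fps_nth (gen_binom_series 0) k = fps_nth (1 + fps_X) k"
    by (cases "k = 0"; cases "k = 1")
       (auto simp: gen_binom_series_def gen_binom_coeff_def cbinom_def)
qed

lemma gen_binom_series_1: "gen_binom_series 1 = inverse (1 - fps_X)"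
proof -
  have "gen_binom_coeff 1 1 k = 1" for k
  proof (cases k)
    case (Suc j)
    have "(of_nat (Suc j) :: complex) gchoose j = of_nat (Suc j)"
      by (simp only: binomial_gbinomial [symmetric] binomial_Suc_n)
    moreover have "nat (int (Suc j) - 1) = j" by simp
    ultimately show ?thesis using Suc
      by (simp add: gen_binom_coeff_def cbinom_def del: of_nat_Suc)
  qed (simp add: gen_binom_coeff_def)
  then have "gen_binom_series 1 = Abs_fps (\<lambda>_. 1)"
    by (simp add: gen_binom_series_def fps_eq_iff)
  then show ?thesis
    by (metis fps_inverse_gp' fps_inverse_idempotent fps_nth_Abs_fps zero_neq_one)
qed

definition diag_coeff :: "complex \<Rightarrow> nat \<Rightarrow> nat \<Rightarrow> complex" where
  "diag_coeff \<beta> n m = fps_nth (gen_binom_series \<beta> ^ m) n"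

definition alpha_series :: "complex \<Rightarrow> nat \<Rightarrow> complex fps" where
  "alpha_series \<beta> n = (1 - fps_X) ^ (n + 1) * Abs_fps (diag_coeff \<beta> n)"

end

theory Submission
  imports Defs "HOL-Computational_Algebra.Polynomial"
begin

text \<open>
  The coefficients \<open>A n \<phi>\<close> of the powers of the generalized binomial series satisfy
  \<open>A n (\<phi> + 1) - A n \<phi> = A (n - 1) (\<phi> + \<beta>)\<close>, the coefficient form of \<open>a = 1 + x a\<^sup>\<beta>\<close>. Both sides
  of the convolution identity \<open>\<Sum>k\<le>n. A k \<phi> * A (n - k) \<psi> = A n (\<phi> + \<psi>)\<close> satisfy this recurrence
  in \<open>\<phi>\<close>; they agree for natural \<open>\<phi>\<close>, hence for all \<open>\<phi>\<close>, being polynomials.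
  Expanding \<open>1 / (1 - x)^(n + 1)\<close>, what remains is an identity between polynomials in
  \<open>b = n \<beta>\<close> of degree less than \<open>n\<close>. It is verified at \<open>b = 0, \<dots>, n - 1\<close>, where at most two
  terms of the sum are nonzero.
\<close>

section \<open>Generalized binomial coefficients as polynomials\<close>

definition gbinomial_poly :: "'a::field_char_0 \<Rightarrow> 'a \<Rightarrow> nat \<Rightarrow> 'a poly" where
  "gbinomial_poly c d k = smult (inverse (fact k)) (\<Prod>i<k. [:c - of_nat i, d:])"

text \<open>The affine argument lets one construction cover \<open>b\<close>, its reflection
  \<open>of_nat (Suc d) - b\<close> and the shifted arguments below.\<close>

lemma poly_gbinomial_poly: "poly (gbinomial_poly c d k) x = (c + d * x) gchoose k"
  by (simp add: gbinomial_poly_def poly_prod gbinomial_prod_rev atLeast0LessThan field_simps)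

lemma degree_gbinomial_poly_le: "degree (gbinomial_poly c d k) \<le> k"
proof -
  have "degree (\<Prod>i<k. [:c - of_nat i, d:]) \<le> (\<Sum>i<k. degree [:c - of_nat i, d:])"
    using degree_prod_sum_le[of "{..<k}" "\<lambda>i. [:c - of_nat i, d:]"] by (simp add: comp_def)
  also have "\<dots> \<le> (\<Sum>i<k. 1)"
    by (intro sum_mono) simp
  finally show ?thesis
    by (simp add: gbinomial_poly_def)
qed

section \<open>Powers of the generalized binomial series\<close>

lemma gen_binom_coeff_0 [simp]: "gen_binom_coeff \<beta> \<phi> 0 = 1"
  by (simp add: gen_binom_coeff_def)

lemma gen_binom_coeff_Suc:
  "gen_binom_coeff \<beta> \<phi> (Suc n) =
     \<phi> / of_nat (Suc n) * ((\<phi> + of_nat (Suc n) * \<beta> - 1) gchoose n)"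
proof -
  have "nat (int (Suc n) - 1) = n"
    by simp
  then show ?thesis
    by (simp add: gen_binom_coeff_def cbinom_def del: of_nat_Suc)
qed

lemma gen_binom_coeff_poly: "\<exists>p. \<forall>\<phi>. gen_binom_coeff \<beta> \<phi> n = poly p \<phi>"
proof (cases n)
  case 0
  then show ?thesis
    by (intro exI[of _ 1]) simp
next
  case (Suc k)
  then show ?thesis
    by (intro exI[of _ "smult (inverse (of_nat n))
                          ([:0, 1:] * gbinomial_poly (of_nat n * \<beta> - 1) 1 k)"])
       (simp add: gen_binom_coeff_Suc poly_gbinomial_poly field_simps del: of_nat_Suc)
qed

text \<open>For n > 0 put z = \<phi> + (n + 1) \<beta> - 1. The right side involves only z choose n
  and z choose (n - 1). Pascal's rule brings the left side to the same two, and absorption, which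
  fixes their ratio, makes the weights agree.\<close>

lemma gen_binom_coeff_step:
  "gen_binom_coeff \<beta> (\<phi> + 1) (Suc n) =
     gen_binom_coeff \<beta> \<phi> (Suc n) + gen_binom_coeff \<beta> (\<phi> + \<beta>) n"
proof (cases n)
  case 0
  then show ?thesis
    by (simp add: gen_binom_coeff_Suc)
next
  case (Suc k)
  define N :: complex where "N = of_nat (Suc n)"
  define z where "z = \<phi> + N * \<beta> - 1"
  have n: "of_nat n = N - 1" "N \<noteq> 0" "N - 1 \<noteq> 0"
    using Suc by (simp_all add: N_def add_eq_0_iff del: of_nat_Suc) (simp_all add: field_simps)
  have pascal: "(z + 1) gchoose n = (z gchoose n) + (z gchoose k)"
    using gbinomial_Suc_Suc[of z k] Suc by simp
  have absorb: "(N - 1) * (z gchoose n) = (z - of_nat k) * (z gchoose k)"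
    using gbinomial_mult_1[of z k] unfolding Suc[symmetric] n(1) by (simp add: algebra_simps)
  have k: "of_nat k = N - 2"
    using n Suc by (simp add: algebra_simps)
  have "gen_binom_coeff \<beta> (\<phi> + 1) (Suc n) = (\<phi> + 1) / N * ((z gchoose n) + (z gchoose k))"
    unfolding gen_binom_coeff_Suc pascal[symmetric] N_def[symmetric]
    by (simp add: z_def algebra_simps)
  moreover have "gen_binom_coeff \<beta> \<phi> (Suc n) = \<phi> / N * (z gchoose n)"
    unfolding gen_binom_coeff_Suc N_def[symmetric] by (simp add: z_def algebra_simps)
  moreover have "gen_binom_coeff \<beta> (\<phi> + \<beta>) n = (\<phi> + \<beta>) / (N - 1) * (z gchoose k)"
    using gen_binom_coeff_Suc[of \<beta> "\<phi> + \<beta>" k] unfolding Suc[symmetric] n(1)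
    by (simp add: z_def algebra_simps)
  moreover have "(\<phi> + 1) / N * ((z gchoose n) + (z gchoose k)) =
      \<phi> / N * (z gchoose n) + (\<phi> + \<beta>) / (N - 1) * (z gchoose k)"
  proof -
    have "(\<phi> + 1) * (N - 1) * ((z gchoose n) + (z gchoose k)) =
        \<phi> * (N - 1) * (z gchoose n) + (\<phi> + \<beta>) * N * (z gchoose k)"
      using absorb k z_def by algebra
    moreover have "(\<phi> + 1) / N * ((z gchoose n) + (z gchoose k)) =
        (\<phi> + 1) * (N - 1) * ((z gchoose n) + (z gchoose k)) / (N * (N - 1))"
      using n(2,3) by simp
    ultimately show ?thesis
      using n(2,3) by (simp add: add_divide_distrib[of "\<phi> * (N - 1) * (z gchoose n)"])
  qed
  ultimately show ?thesis
    by simp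
qed

lemma gen_binom_coeff_convolution:
  "(\<Sum>k\<le>n. gen_binom_coeff \<beta> \<phi> k * gen_binom_coeff \<beta> \<psi> (n - k)) =
     gen_binom_coeff \<beta> (\<phi> + \<psi>) n"
\<comment> \<open>The recurrence lowers n but moves \<phi> to \<phi> + \<beta>, which need not be
  natural. So the passage from natural to arbitrary \<phi> has to be made at every n, not once at
  the end.\<close>
proof (induction n arbitrary: \<phi>)
  case 0
  then show ?case
    by simp
next
  case (Suc n)
  note IH = Suc.IH
  let ?A = "gen_binom_coeff \<beta>"
  let ?S = "\<lambda>\<phi>. \<Sum>k\<le>Suc n. ?A \<phi> k * ?A \<psi> (Suc n - k)"
  \<comment> \<open>The term k = 0 does not depend on \<phi>; all others have a positive index, so
    the recurrence applies to them.\<close>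
  have split: "?S \<phi> = ?A \<psi> (Suc n) + (\<Sum>k\<le>n. ?A \<phi> (Suc k) * ?A \<psi> (n - k))" for \<phi>
    by (subst sum.atMost_Suc_shift) simp
  have nat: "?S (of_nat m) = ?A (of_nat m + \<psi>) (Suc n)" for m
  proof (induction m)
    case 0
    show ?case
      unfolding split by (simp add: gen_binom_coeff_Suc)
  next
    case (Suc m)
    have "?S (of_nat (Suc m)) =
        ?S (of_nat m) + (\<Sum>k\<le>n. ?A (of_nat m + \<beta>) k * ?A \<psi> (n - k))"
      unfolding split of_nat_Suc add.commute[of 1 "of_nat m"] gen_binom_coeff_step
      by (simp add: distrib_right sum.distrib)
    also have "\<dots> = ?A (of_nat m + \<psi>) (Suc n) + ?A (of_nat m + \<psi> + \<beta>) n"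
      unfolding Suc.IH IH by (simp add: algebra_simps)
    also have "\<dots> = ?A (of_nat (Suc m) + \<psi>) (Suc n)"
      using gen_binom_coeff_step[of \<beta> "of_nat m + \<psi>" n] by (simp add: algebra_simps)
    finally show ?case .
  qed
  obtain p where p: "\<And>k \<phi>. ?A \<phi> k = poly (p k) \<phi>"
    using gen_binom_coeff_poly[of \<beta>] by metis
  \<comment> \<open>For fixed \<psi>, \<open>q\<close> is the difference of the two sides as a
    polynomial in \<phi>; every natural number is a root.\<close>
  define q where
    "q = (\<Sum>k\<le>Suc n. smult (?A \<psi> (Suc n - k)) (p k)) - pcompose (p (Suc n)) [:\<psi>, 1:]"
  have q: "poly q \<phi> = ?S \<phi> - ?A (\<phi> + \<psi>) (Suc n)" for \<phi>
    unfolding q_def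
    by (simp add: poly_sum poly_pcompose p[of _ "Suc n", symmetric] p[symmetric] add.commute
        mult.commute del: sum.atMost_Suc)
  have "range of_nat \<subseteq> {x. poly q x = 0}"
    using nat by (auto simp: q simp del: sum.atMost_Suc)
  moreover have "infinite (range (of_nat :: nat \<Rightarrow> complex))"
    by (simp add: finite_image_iff inj_of_nat)
  ultimately have "q = 0"
    using poly_roots_finite finite_subset by blast
  then show ?case
    using q[of \<phi>] by (simp del: sum.atMost_Suc)
qed

text \<open>Each further factor of the series is the convolution identity at \<phi> = 1.\<close>

lemma gen_binom_series_power_nth:
  "fps_nth (gen_binom_series \<beta> ^ m) n = gen_binom_coeff \<beta> (of_nat m) n"
proof (induction m arbitrary: n)
  case 0
  show ?case
    by (cases n) (simp_all add: gen_binom_coeff_Suc)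
next
  case (Suc m)
  show ?case
    using gen_binom_coeff_convolution[of \<beta> 1 "of_nat m" n]
    unfolding power_Suc fps_mult_nth Suc.IH
    by (simp add: gen_binom_series_def atLeast0AtMost)
qed

section \<open>The finite binomial identity\<close>

lemma gbinomial_diagonal_expansion_nat:
  assumes "t \<le> d"
  shows "(\<Sum>i\<le>d. of_nat (Suc d - t choose i) * of_nat (t choose (d - i)) *
            of_nat ((j + d - i) choose Suc d)) =
         (of_nat j * ((of_nat j + of_nat t - 1) gchoose d) :: complex)"
\<comment> \<open>The first factor vanishes for i > d + 1 - t, the second for i < d - t. This leaves
  i = d - t and i = d - t + 1, and the latter is out of range exactly when t = 0.\<close>
proof (cases t)
  case 0
  have "(\<Sum>i\<le>d. of_nat (Suc d - t choose i) * of_nat (t choose (d - i)) *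
            of_nat ((j + d - i) choose Suc d)) =
        (\<Sum>i\<in>{d}. of_nat (Suc d - t choose i) * of_nat (t choose (d - i)) *
            of_nat ((j + d - i) choose Suc d) :: complex)"
    using 0 by (intro sum.mono_neutral_right) auto
  also have "\<dots> = of_nat (Suc d) * (of_nat j gchoose Suc d)"
    using 0 by (simp add: binomial_gbinomial)
  also have "\<dots> = of_nat j * ((of_nat j - 1) gchoose d)"
    by (rule gbinomial_absorption)
  finally show ?thesis
    using 0 by simp
next
  case (Suc s)
  define e where "e = d - t"
  have d: "d = e + Suc s"
    using assms Suc by (simp add: e_def)
  define z :: complex where "z = of_nat (j + s)"
  have "(\<Sum>i\<le>d. of_nat (Suc d - t choose i) * of_nat (t choose (d - i)) *
            of_nat ((j + d - i) choose Suc d)) =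
        (\<Sum>i\<in>{e, Suc e}. of_nat (Suc d - t choose i) * of_nat (t choose (d - i)) *
            of_nat ((j + d - i) choose Suc d) :: complex)"
  proof (intro sum.mono_neutral_right ballI)
    fix i assume i: "i \<in> {..d} - {e, Suc e}"
    then consider "i < e" | "i > Suc e"
      by force
    then show "of_nat (Suc d - t choose i) * of_nat (t choose (d - i)) *
        of_nat ((j + d - i) choose Suc d) = (0 :: complex)"
      by cases (auto simp: d Suc)
  qed (auto simp: d)
  also have "\<dots> = of_nat (Suc e) * ((z + 1) gchoose Suc d) + of_nat (Suc s) * (z gchoose Suc d)"
  proof -
    have "Suc d - t = Suc e" "d - e = Suc s" "d - Suc e = s" "t = Suc s"
         "j + d - e = Suc (j + s)" "j + d - Suc e = j + s"
      by (simp_all add: d Suc)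
    moreover have "of_nat (Suc (j + s) choose Suc d) = (z + 1) gchoose Suc d"
      by (simp only: binomial_gbinomial z_def of_nat_Suc add.commute)
    moreover have "of_nat (j + s choose Suc d) = z gchoose Suc d"
      by (simp only: binomial_gbinomial z_def)
    ultimately show ?thesis
      by (simp del: of_nat_Suc binomial_Suc_Suc add: of_nat_Suc[of 0])
  qed
  \<comment> \<open>After Pascal's rule the weights e + 1 and s + 1 add up to d + 1, the factor that
    absorption needs.\<close>
  also have "\<dots> = of_nat (Suc d) * (z gchoose Suc d) + of_nat (Suc e) * (z gchoose d)"
    unfolding gbinomial_Suc_Suc by (simp add: d algebra_simps)
  also have "of_nat (Suc d) * (z gchoose Suc d) = (z - of_nat d) * (z gchoose d)"
    using gbinomial_mult_1[of z d] by (simp add: algebra_simps)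
  also have "(z - of_nat d) * (z gchoose d) + of_nat (Suc e) * (z gchoose d) =
      of_nat j * (z gchoose d)"
    by (simp add: z_def d algebra_simps)
  finally show ?thesis
    by (simp add: z_def Suc)
qed

text \<open>For n = d + 1 and b = n \<beta> the right side is n times the coefficient of x^n in the
  j-th power of the series; the left side comes from expanding 1 / (1 - x)^(n + 1).\<close>

lemma gbinomial_diagonal_expansion:
  "(\<Sum>i\<le>d. ((of_nat (Suc d) - b) gchoose i) * (b gchoose (d - i)) *
       of_nat ((j + d - i) choose Suc d)) =
   of_nat j * ((of_nat j + b - 1) gchoose d)" for b :: complex
proof -
  define p where "p = (\<Sum>i\<le>d. smult (of_nat ((j + d - i) choose Suc d))
    (gbinomial_poly (of_nat (Suc d)) (-1) i * gbinomial_poly 0 1 (d - i)) :: complex poly)"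
  define q :: "complex poly" where "q = smult (of_nat j) (gbinomial_poly (of_nat j - 1) 1 d)"
  have p: "poly p b = (\<Sum>i\<le>d. ((of_nat (Suc d) - b) gchoose i) * (b gchoose (d - i)) *
      of_nat ((j + d - i) choose Suc d))" for b
    by (simp add: p_def poly_sum poly_gbinomial_poly mult_ac del: of_nat_Suc)
  have q: "poly q b = of_nat j * ((of_nat j + b - 1) gchoose d)" for b
    by (simp add: q_def poly_gbinomial_poly algebra_simps)
  \<comment> \<open>The i-th product has degree at most i + (d - i), so the d + 1 nodes 0, ..., d
    suffice.\<close>
  have "degree p \<le> d"
    unfolding p_def
  proof (intro degree_sum_le)
    fix i assume "i \<in> {..d}"
    then show "degree (smult (of_nat ((j + d - i) choose Suc d))
        (gbinomial_poly (of_nat (Suc d)) (-1) i * gbinomial_poly 0 1 (d - i)) :: complex poly) \<le> d"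
      using degree_mult_le[of "gbinomial_poly (of_nat (Suc d) :: complex) (-1) i"
            "gbinomial_poly 0 1 (d - i)"]
          degree_gbinomial_poly_le[of "of_nat (Suc d) :: complex" "-1" i]
          degree_gbinomial_poly_le[of "0 :: complex" 1 "d - i"]
      by (intro order.trans[OF degree_smult_le]) simp
  qed simp
  moreover have "degree q \<le> d"
    unfolding q_def using degree_gbinomial_poly_le order.trans[OF degree_smult_le] by blast
  moreover have "poly p x = poly q x" if x_in: "x \<in> of_nat ` {..d}" for x
  proof -
    obtain t where t: "t \<le> d" "x = of_nat t"
      using x_in by auto
    then have diff: "of_nat (Suc d) - of_nat t = (of_nat (Suc d - t) :: complex)"
      by (simp add: of_nat_diff del: of_nat_Suc)
    show ?thesis
      unfolding p q t(2) diff binomial_gbinomial[symmetric]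
      by (rule gbinomial_diagonal_expansion_nat[OF t(1)])
  qed
  moreover have "card (of_nat ` {..d} :: complex set) = Suc d"
    by (simp add: card_image inj_on_def)
  ultimately have "p = q"
    by (intro poly_eqI_degree[of "of_nat ` {..d}"]) auto
  then show ?thesis
    using p q by metis
qed

section \<open>Comparison of the generating functions\<close>

lemma inverse_one_minus_fps_X_power_Suc:
  "inverse ((1 - fps_X :: 'a::field_char_0 fps) ^ Suc n) = Abs_fps (\<lambda>k. of_nat ((n + k) choose n))"
  \<comment> \<open>Symmetry puts the fixed n below, so that multiplying by a power of x changes
    only the upper index.\<close>
  using one_minus_const_fps_X_neg_power'[of "Suc n" "1 :: 'a"]
  by (simp add: fps_eq_iff binomial_symmetric[of n] del: power_Suc)

theorem theorem2p5:
  fixes \<beta> :: complex and n :: nat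
  assumes "n \<ge> 1"
  shows "alpha_series \<beta> n =
    fps_const (1 / of_nat n) *
      (\<Sum>m=0..n. fps_const (cbinom (of_nat n * (1 - \<beta>)) (int m - 1)
                            * cbinom (of_nat n * \<beta>) (int n - int m)) * fps_X ^ m)"
proof -
  obtain d where n: "n = Suc d"
    using assms by (cases n) auto
  define b where "b = of_nat n * \<beta>"
  define c where "c i = ((of_nat (Suc d) - b) gchoose i) * (b gchoose (d - i))" for i
  define P where "P = (\<Sum>m=0..n. fps_const (cbinom (of_nat n * (1 - \<beta>)) (int m - 1)
                            * cbinom (of_nat n * \<beta>) (int n - int m)) * fps_X ^ m)"
  \<comment> \<open>The term m = 0 vanishes because its lower index is -1; the others are renumbered
    by m = i + 1.\<close>
  have P: "P = (\<Sum>i\<le>d. fps_const (c i) * fps_X ^ Suc i)"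
  proof -
    have "cbinom (of_nat n * (1 - \<beta>)) (int (Suc i) - 1) * cbinom (of_nat n * \<beta>) (int n - int (Suc i))
        = c i" if "i \<le> d" for i
    proof -
      have "nat (int (Suc i) - 1) = i" "nat (int n - int (Suc i)) = d - i"
           "of_nat n * (1 - \<beta>) = of_nat (Suc d) - b"
        using that by (simp_all add: n b_def algebra_simps)
      then show ?thesis
        using that by (simp add: cbinom_def c_def b_def n del: of_nat_Suc)
    qed
    moreover have "cbinom (of_nat n * (1 - \<beta>)) (int 0 - 1) = 0"
      by (simp add: cbinom_def)
    ultimately show ?thesis
      unfolding P_def atLeast0AtMost n sum.atMost_Suc_shift by simp
  qed
  let ?Q = "(1 - fps_X :: complex fps) ^ Suc n"
  \<comment> \<open>\<open>?Q\<close> has constant coefficient 1 and is a unit, so the claim may be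
    compared after division by it.\<close>
  have "fps_nth (Abs_fps (diag_coeff \<beta> n)) j = fps_nth (fps_const (1 / of_nat n) * P * inverse ?Q) j"
    for j
  proof -
    have coeff: "fps_nth (fps_X ^ Suc i * inverse ?Q) j = of_nat ((j + d - i) choose n)"
      if "i \<le> d" for i
    \<comment> \<open>The formula also covers j \<le> i: the shift gives 0 there, and so does the
      binomial, since j + d - i < n.\<close>
    proof (cases "j < Suc i")
      case True
      then have "j + d - i < n"
        using that by (simp add: n)
      then show ?thesis
        using True by (simp only: fps_X_power_mult_nth) simp
    next
      case False
      then have "n + (j - Suc i) = j + d - i"
        by (simp add: n)
      then show ?thesis
        using False by (simp only: fps_X_power_mult_nth inverse_one_minus_fps_X_power_Suc) simp
    qed
    have "fps_nth (P * inverse ?Q) j =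
        (\<Sum>i\<le>d. c i * fps_nth (fps_X ^ Suc i * inverse ?Q) j)"
      unfolding P sum_distrib_right fps_sum_nth mult.assoc fps_mult_left_const_nth ..
    also have "\<dots> = of_nat j * ((of_nat j + b - 1) gchoose d)"
      unfolding gbinomial_diagonal_expansion[symmetric]
      by (intro sum.cong refl) (simp add: coeff[unfolded n] c_def n del: power_Suc of_nat_Suc binomial_Suc_Suc)
    finally show ?thesis
      unfolding mult.assoc
      by (simp add: diag_coeff_def gen_binom_series_power_nth n gen_binom_coeff_Suc b_def
          del: power_Suc of_nat_Suc)
  qed
  then have "Abs_fps (diag_coeff \<beta> n) = fps_const (1 / of_nat n) * P * inverse ?Q"
    by (intro fps_ext)
  moreover have "?Q * inverse ?Q = 1"
    by (intro inverse_mult_eq_1') (simp add: fps_power_zeroth)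
  ultimately show ?thesis
    unfolding alpha_series_def P_def[symmetric] by (simp add: mult_ac del: power_Suc)
qed

end
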